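(* Let $X$ be a simplicial set with finitely many nondegenerate simplices, $Y$ a simplicial group, and $p\in\mathrm{sSet}(X,D(Y))$. 1. $p$ is strongly contextual if and only if $p$ is strongly non-invertible in the real convex monoid $\mathrm{sSet}(X,D(Y))$. 2. $p$ is strongly contextual if and only if $\mathrm{CF}(p)=1$.
   Context: For a set $S$, $D(S)=D_{\mathbb{R}_{\ge0}}(S)$ is the set of functions $p:S\to\mathbb{R}_{\ge0}$ of finite support with $\sum_s p(s)=1$; $D(f)(p)(t)=\sum_{f(s)=t}p(s)$; $\delta^s$ is the delta distribution. For a simplicial set $Y$, $D(Y)$ is obtained by applying $D$ degreewise. For $p\in\mathrm{sSet}(X,D(Y))$, $\mathrm{supp}(p)=\{\varphi\in\mathrm{sSet}(X,Y):p_n(x)(\varphi_n(x))\ne0\ \ \forall x\in X_n,\ n\ge0\}$; $p$ is strongly contextual if $\mathrm{supp}(p)=\emptyset$. The map $\Theta_{X,Y}:D(\mathrm{sSet}(X,Y))\to\mathrm{sSet}(X,D(Y))$ is $\Theta_{X,Y}(d)_n(x)=\sum_{\varphi}d(\varphi)\delta^{\varphi_n(x)}$; elements in its image are called noncontextual. $\mathrm{NCF}(p)$ is the supremum of $\alpha\in[0,1]$ such that $p=\alpha q+(1-\alpha)s$ (pointwise convex combination) for some $q,s\in\mathrm{sSet}(X,D(Y))$ with $q$ noncontextual, and $\mathrm{CF}(p)=1-\mathrm{NCF}(p)$. $M=\mathrm{sSet}(X,D(Y))$ is a monoid under $(p\cdot q)_n(x)(y)=\sum_{y_1y_2=y}p_n(x)(y_1)q_n(x)(y_2)$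 with unit $x\mapsto\delta^{e}$ ($e$ the identity of $Y_n$), with convex structure map $\pi:D(M)\to M$, $\pi(Q)_n(x)=\sum_{q\in M}Q(q)q_n(x)$. Let $M^*$ be the set of invertible elements. The invertible support of $m\in M$ is $\mathrm{Isupp}(m)=\{m'\in M^*:\exists P\in D(M),\ \pi(P)=m,\ P(m')\ne0\}$; $m$ is strongly non-invertible if $\mathrm{Isupp}(m)=\emptyset$. *)

theory Defs
  imports "HOL-Probability.Probability_Mass_Function" "HOL-Algebra.Group"
begin

section \<open>Simplicial sets and simplicial groups\<close>

text \<open>
  All degrees live in one ambient type; degrees may overlap as sets. \<open>face X n i\<close> is
  \<open>d\<^sub>i : X\<^sub>n\<^sub>+\<^sub>1 \<rightarrow> X\<^sub>n\<close> (for \<open>i \<le> n + 1\<close>) and \<open>degen X n i\<close> is \<open>s\<^sub>i : X\<^sub>n \<rightarrow> X\<^sub>n\<^sub>+\<^sub>1\<close>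
  (for \<open>i \<le> n\<close>); their values at other arguments are irrelevant.
\<close>

record 'a sset =
  simplices :: "nat \<Rightarrow> 'a set"
  face :: "nat \<Rightarrow> nat \<Rightarrow> 'a \<Rightarrow> 'a"
  degen :: "nat \<Rightarrow> nat \<Rightarrow> 'a \<Rightarrow> 'a"

locale simplicial_set =
  fixes X :: "('a, 'm) sset_scheme"
  assumes face_closed:
      "\<lbrakk>i \<le> Suc n; x \<in> simplices X (Suc n)\<rbrakk> \<Longrightarrow> face X n i x \<in> simplices X n"
    and degen_closed:
      "\<lbrakk>i \<le> n; x \<in> simplices X n\<rbrakk> \<Longrightarrow> degen X n i x \<in> simplices X (Suc n)"
    and face_face:
      "\<lbrakk>i < j; j \<le> Suc (Suc n); x \<in> simplices X (Suc (Suc n))\<rbrakk> \<Longrightarrow>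
        face X n i (face X (Suc n) j x) = face X n (j - 1) (face X (Suc n) i x)"
    and face_degen_less:
      "\<lbrakk>i < j; j \<le> Suc n; x \<in> simplices X (Suc n)\<rbrakk> \<Longrightarrow>
        face X (Suc n) i (degen X (Suc n) j x) = degen X n (j - 1) (face X n i x)"
    and face_degen_same:
      "\<lbrakk>j \<le> n; x \<in> simplices X n\<rbrakk> \<Longrightarrow> face X n j (degen X n j x) = x"
    and face_degen_Suc:
      "\<lbrakk>j \<le> n; x \<in> simplices X n\<rbrakk> \<Longrightarrow> face X n (Suc j) (degen X n j x) = x"
    and face_degen_greater:
      "\<lbrakk>Suc j < i; i \<le> Suc (Suc n); x \<in> simplices X (Suc n)\<rbrakk> \<Longrightarrow>
        face X (Suc n) i (degen X (Suc n) j x) = degen X n j (face X n (i - 1) x)"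
    and degen_degen:
      "\<lbrakk>i \<le> j; j \<le> n; x \<in> simplices X n\<rbrakk> \<Longrightarrow>
        degen X (Suc n) i (degen X n j x) = degen X (Suc n) (Suc j) (degen X n i x)"

definition degenerate :: "('a, 'm) sset_scheme \<Rightarrow> nat \<Rightarrow> 'a \<Rightarrow> bool" where
  "degenerate X n x \<longleftrightarrow>
    (\<exists>m i y. n = Suc m \<and> i \<le> m \<and> y \<in> simplices X m \<and> x = degen X m i y)"

definition nondegenerate_simplices :: "('a, 'm) sset_scheme \<Rightarrow> (nat \<times> 'a) set" where
  "nondegenerate_simplices X = {(n, x). x \<in> simplices X n \<and> \<not> degenerate X n x}"

text \<open>
  Simplicial maps are extensional in each degree (\<open>undefined\<close> off \<open>X\<^sub>n\<close>), so that equality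
  in HOL is equality of simplicial maps.
\<close>

definition sSet :: "('a, 'm) sset_scheme \<Rightarrow> ('b, 'k) sset_scheme \<Rightarrow> (nat \<Rightarrow> 'a \<Rightarrow> 'b) set" where
  "sSet X Y = {f.
     (\<forall>n. f n \<in> simplices X n \<rightarrow>\<^sub>E simplices Y n) \<and>
     (\<forall>n. \<forall>i \<le> Suc n. \<forall>x \<in> simplices X (Suc n). f n (face X n i x) = face Y n i (f (Suc n) x)) \<and>
     (\<forall>n. \<forall>i \<le> n. \<forall>x \<in> simplices X n. f (Suc n) (degen X n i x) = degen Y n i (f n x))}"

record 'a sgroup = "'a sset" +
  smult :: "nat \<Rightarrow> 'a \<Rightarrow> 'a \<Rightarrow> 'a"
  sone :: "nat \<Rightarrow> 'a"

definition level :: "('a, 'm) sgroup_scheme \<Rightarrow> nat \<Rightarrow> 'a monoid" where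
  "level Y n = \<lparr>carrier = simplices Y n, mult = smult Y n, one = sone Y n\<rparr>"

locale simplicial_group = simplicial_set Y
  for Y :: "('a, 'm) sgroup_scheme" +
  assumes group_level: "group (level Y n)"
    and face_hom: "i \<le> Suc n \<Longrightarrow> face Y n i \<in> hom (level Y (Suc n)) (level Y n)"
    and degen_hom: "i \<le> n \<Longrightarrow> degen Y n i \<in> hom (level Y n) (level Y (Suc n))"


section \<open>Distributions\<close>

text \<open>
  \<open>D(S)\<close> is rendered by finitely supported probability mass functions on the ambient type
  whose support lies in \<open>S\<close>; \<open>D(f)\<close> is \<open>map_pmf f\<close> and \<open>\<delta>\<^sup>s\<close> is \<open>return_pmf s\<close>.
\<close>

definition fdist :: "'a set \<Rightarrow> 'a pmf set" where
  "fdist S = {p. finite (set_pmf p) \<and> set_pmf p \<subseteq> S}"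

lemma pmf_bind_finite:
  assumes "finite (set_pmf p)"
  shows "pmf (bind_pmf p f) y = (\<Sum>s\<in>set_pmf p. pmf p s * pmf (f s) y)"
  using assms by (simp add: pmf_bind integral_measure_pmf[of "set_pmf p"])

lemma fdist_sum_eq_1:
  assumes "p \<in> fdist S"
  shows "(\<Sum>s\<in>{s\<in>S. pmf p s \<noteq> 0}. pmf p s) = 1"
proof -
  have "{s\<in>S. pmf p s \<noteq> 0} = set_pmf p"
    using assms by (auto simp: fdist_def set_pmf_iff)
  then show ?thesis
    using assms by (simp add: fdist_def sum_pmf_eq_1)
qed

lemma fdist_of_function:
  assumes nonneg: "\<And>s. s \<in> S \<Longrightarrow> f s \<ge> 0" and fin: "finite {s\<in>S. f s \<noteq> 0}"
    and sum: "(\<Sum>s\<in>{s\<in>S. f s \<noteq> 0}. f s) = 1"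
  shows "\<exists>!p. p \<in> fdist S \<and> (\<forall>s\<in>S. pmf p s = f s)"
proof -
  define g where "g s = (if s \<in> S then f s else 0)" for s
  have g: "g s \<ge> 0" for s using nonneg by (simp add: g_def)
  have supp: "{s. g s \<noteq> 0} = {s\<in>S. f s \<noteq> 0}" by (auto simp: g_def)
  have "(\<integral>\<^sup>+s. ennreal (g s) \<partial>count_space UNIV) = (\<Sum>s\<in>{s\<in>S. f s \<noteq> 0}. ennreal (g s))"
    by (rule nn_integral_count_space'[OF fin]) (auto simp: g_def)
  also have "\<dots> = ennreal (\<Sum>s\<in>{s\<in>S. f s \<noteq> 0}. g s)"
    using g by (intro sum_ennreal) blast
  also have "(\<Sum>s\<in>{s\<in>S. f s \<noteq> 0}. g s) = 1"
    unfolding sum[symmetric] by (rule sum.cong) (auto simp: g_def)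
  finally have g1: "(\<integral>\<^sup>+s. ennreal (g s) \<partial>count_space UNIV) = 1" by simp
  have pmf: "pmf (embed_pmf g) s = g s" for s
    by (rule pmf_embed_pmf[OF g g1])
  have "set_pmf (embed_pmf g) = {s\<in>S. f s \<noteq> 0}"
    using pmf supp by (auto simp: set_pmf_iff)
  then have ex: "embed_pmf g \<in> fdist S \<and> (\<forall>s\<in>S. pmf (embed_pmf g) s = f s)"
    using fin by (auto simp: fdist_def pmf g_def)
  show ?thesis
  proof (rule ex1I[where a = "embed_pmf g"], rule ex)
    fix p assume p: "p \<in> fdist S \<and> (\<forall>s\<in>S. pmf p s = f s)"
    then have "pmf p s = g s" for s
      by (cases "s \<in> S") (auto simp: g_def fdist_def set_pmf_iff)
    then show "p = embed_pmf g" by (intro pmf_eqI) (simp add: pmf)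
  qed
qed

lemma pmf_map_fdist:
  assumes "p \<in> fdist S"
  shows "pmf (map_pmf f p) t = (\<Sum>s\<in>{s\<in>set_pmf p. f s = t}. pmf p s)"
proof -
  have fin: "finite (set_pmf p)" using assms by (simp add: fdist_def)
  have "pmf (map_pmf f p) t = (\<Sum>s\<in>set_pmf p. if f s = t then pmf p s else 0)"
    unfolding map_pmf_def pmf_bind_finite[OF fin]
    by (rule sum.cong) (auto simp: indicator_def)
  also have "\<dots> = (\<Sum>s\<in>{s\<in>set_pmf p. f s = t}. pmf p s)"
    using fin by (simp add: sum.inter_filter)
  finally show ?thesis .
qed

definition Dist :: "('b, 'm) sset_scheme \<Rightarrow> 'b pmf sset" where
  "Dist Y = \<lparr>simplices = \<lambda>n. fdist (simplices Y n),
             face = \<lambda>n i. map_pmf (face Y n i),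
             degen = \<lambda>n i. map_pmf (degen Y n i)\<rparr>"


section \<open>Contextuality\<close>

definition supp ::
    "('a, 'm) sset_scheme \<Rightarrow> ('b, 'k) sset_scheme \<Rightarrow> (nat \<Rightarrow> 'a \<Rightarrow> 'b pmf) \<Rightarrow> (nat \<Rightarrow> 'a \<Rightarrow> 'b) set"
  where "supp X Y p = {\<phi> \<in> sSet X Y. \<forall>n. \<forall>x \<in> simplices X n. pmf (p n x) (\<phi> n x) \<noteq> 0}"

definition strongly_contextual ::
    "('a, 'm) sset_scheme \<Rightarrow> ('b, 'k) sset_scheme \<Rightarrow> (nat \<Rightarrow> 'a \<Rightarrow> 'b pmf) \<Rightarrow> bool"
  where "strongly_contextual X Y p \<longleftrightarrow> supp X Y p = {}"

definition Theta ::
    "('a, 'm) sset_scheme \<Rightarrow> (nat \<Rightarrow> 'a \<Rightarrow> 'b) pmf \<Rightarrow> nat \<Rightarrow> 'a \<Rightarrow> 'b pmf"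
  where "Theta X d = (\<lambda>n. \<lambda>x \<in> simplices X n. bind_pmf d (\<lambda>\<phi>. return_pmf (\<phi> n x)))"

lemma pmf_Theta:
  assumes "d \<in> fdist (sSet X Y)" "x \<in> simplices X n"
  shows "pmf (Theta X d n x) y = (\<Sum>\<phi>\<in>set_pmf d. pmf d \<phi> * pmf (return_pmf (\<phi> n x)) y)"
  using assms by (simp add: Theta_def fdist_def pmf_bind_finite)

definition noncontextual ::
    "('a, 'm) sset_scheme \<Rightarrow> ('b, 'k) sset_scheme \<Rightarrow> (nat \<Rightarrow> 'a \<Rightarrow> 'b pmf) \<Rightarrow> bool"
  where "noncontextual X Y p \<longleftrightarrow> p \<in> Theta X ` fdist (sSet X Y)"

text \<open>
  The set below is bounded above by 1, and contains 0 as soon as \<open>sSet X Y\<close> is nonempty (in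
  particular for a simplicial group \<open>Y\<close>), so \<open>Sup\<close> is then the true supremum.
\<close>

definition NCF ::
    "('a, 'm) sset_scheme \<Rightarrow> ('b, 'k) sset_scheme \<Rightarrow> (nat \<Rightarrow> 'a \<Rightarrow> 'b pmf) \<Rightarrow> real"
  where "NCF X Y p = Sup {\<alpha> \<in> {0..1}.
    \<exists>q \<in> sSet X (Dist Y). \<exists>s \<in> sSet X (Dist Y). noncontextual X Y q \<and>
      (\<forall>n. \<forall>x \<in> simplices X n. \<forall>y.
        pmf (p n x) y = \<alpha> * pmf (q n x) y + (1 - \<alpha>) * pmf (s n x) y)}"

definition CF ::
    "('a, 'm) sset_scheme \<Rightarrow> ('b, 'k) sset_scheme \<Rightarrow> (nat \<Rightarrow> 'a \<Rightarrow> 'b pmf) \<Rightarrow> real"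
  where "CF X Y p = 1 - NCF X Y p"


section \<open>Invertible support in a real convex monoid\<close>

text \<open>\<open>\<pi>\<close> is the convex structure map \<open>D(M) \<rightarrow> M\<close>.\<close>

definition Isupp :: "('c, 'm) monoid_scheme \<Rightarrow> ('c pmf \<Rightarrow> 'c) \<Rightarrow> 'c \<Rightarrow> 'c set" where
  "Isupp M \<pi> m = {m' \<in> Units M. \<exists>P \<in> fdist (carrier M). \<pi> P = m \<and> pmf P m' \<noteq> 0}"

definition strongly_non_invertible ::
    "('c, 'm) monoid_scheme \<Rightarrow> ('c pmf \<Rightarrow> 'c) \<Rightarrow> 'c \<Rightarrow> bool"
  where "strongly_non_invertible M \<pi> m \<longleftrightarrow> Isupp M \<pi> m = {}"

definition conv_monoid ::
    "('a, 'm) sset_scheme \<Rightarrow> ('b, 'k) sgroup_scheme \<Rightarrow> (nat \<Rightarrow> 'a \<Rightarrow> 'b pmf) monoid"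
  where "conv_monoid X Y =
    \<lparr>carrier = sSet X (Dist Y),
     mult = \<lambda>p q n. \<lambda>x \<in> simplices X n.
       map_pmf (\<lambda>(y1, y2). y1 \<otimes>\<^bsub>level Y n\<^esub> y2) (pair_pmf (p n x) (q n x)),
     one = \<lambda>n. \<lambda>x \<in> simplices X n. return_pmf \<one>\<^bsub>level Y n\<^esub>\<rparr>"

definition conv_struct ::
    "('a, 'm) sset_scheme \<Rightarrow> (nat \<Rightarrow> 'a \<Rightarrow> 'b pmf) pmf \<Rightarrow> nat \<Rightarrow> 'a \<Rightarrow> 'b pmf"
  where "conv_struct X Q = (\<lambda>n. \<lambda>x \<in> simplices X n. bind_pmf Q (\<lambda>q. q n x))"

lemma pmf_conv_mult:
  assumes "p \<in> sSet X (Dist Y)" "q \<in> sSet X (Dist Y)" "x \<in> simplices X n"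
  shows "pmf ((p \<otimes>\<^bsub>conv_monoid X Y\<^esub> q) n x) y =
    (\<Sum>(y1, y2) \<in> {(y1, y2). y1 \<in> set_pmf (p n x) \<and> y2 \<in> set_pmf (q n x) \<and> y1 \<otimes>\<^bsub>level Y n\<^esub> y2 = y}.
      pmf (p n x) y1 * pmf (q n x) y2)"
proof -
  have "p n x \<in> fdist (simplices Y n)" "q n x \<in> fdist (simplices Y n)"
    using assms by (auto simp: sSet_def Dist_def)
  then have "pair_pmf (p n x) (q n x) \<in> fdist UNIV"
    by (simp add: fdist_def)
  note map = pmf_map_fdist[OF this, of "\<lambda>(y1, y2). y1 \<otimes>\<^bsub>level Y n\<^esub> y2" y]
  have "(p \<otimes>\<^bsub>conv_monoid X Y\<^esub> q) n x =
      map_pmf (\<lambda>(y1, y2). y1 \<otimes>\<^bsub>level Y n\<^esub> y2) (pair_pmf (p n x) (q n x))"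
    using assms(3) by (simp add: conv_monoid_def)
  then show ?thesis
    by (simp only:) (subst map, rule sum.cong, auto simp: pmf_pair)
qed

lemma pmf_conv_struct:
  assumes "Q \<in> fdist (sSet X (Dist Y))" "x \<in> simplices X n"
  shows "pmf (conv_struct X Q n x) y = (\<Sum>q\<in>set_pmf Q. pmf Q q * pmf (q n x) y)"
  using assms by (simp add: conv_struct_def fdist_def pmf_bind_finite)

lemma set_pmf_sSet_Dist:
  assumes "p \<in> sSet X (Dist Y)" "x \<in> simplices X n"
  shows "set_pmf (p n x) \<subseteq> simplices Y n" "finite (set_pmf (p n x))"
  using assms by (auto simp: sSet_def Dist_def fdist_def PiE_iff)


lemma simplicial_set_Dist:
  assumes "simplicial_set Y"
  shows "simplicial_set (Dist Y)"
proof -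
  interpret simplicial_set Y by fact
  have id: "map_pmf f p = p" if "\<And>x. x \<in> set_pmf p \<Longrightarrow> f x = x" for f and p :: "'a pmf"
    using that map_pmf_cong[OF refl, of p f "\<lambda>x. x"] by simp
  show ?thesis
    by unfold_locales
      (auto simp: Dist_def fdist_def map_pmf_comp subset_iff
        intro!: map_pmf_cong id face_closed degen_closed face_degen_same face_degen_Suc degen_degen
          face_face[simplified] face_degen_less[simplified] face_degen_greater[simplified])
qed

lemma sSet_DistD:
  assumes "p \<in> sSet X (Dist Y)"
  shows "x \<in> simplices X n \<Longrightarrow> p n x \<in> fdist (simplices Y n)"
    and "x \<notin> simplices X n \<Longrightarrow> p n x = undefined"
    and "\<lbrakk>i \<le> Suc n; x \<in> simplices X (Suc n)\<rbrakk> \<Longrightarrow>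
      p n (face X n i x) = map_pmf (face Y n i) (p (Suc n) x)"
    and "\<lbrakk>i \<le> n; x \<in> simplices X n\<rbrakk> \<Longrightarrow>
      p (Suc n) (degen X n i x) = map_pmf (degen Y n i) (p n x)"
  using assms by (auto simp: sSet_def Dist_def PiE_iff extensional_def)

lemma sSet_DistI:
  assumes "\<And>n x. x \<in> simplices X n \<Longrightarrow> p n x \<in> fdist (simplices Y n)"
    and "\<And>n x. x \<notin> simplices X n \<Longrightarrow> p n x = undefined"
    and "\<And>i n x. \<lbrakk>i \<le> Suc n; x \<in> simplices X (Suc n)\<rbrakk> \<Longrightarrow>
      p n (face X n i x) = map_pmf (face Y n i) (p (Suc n) x)"
    and "\<And>i n x. \<lbrakk>i \<le> n; x \<in> simplices X n\<rbrakk> \<Longrightarrow>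
      p (Suc n) (degen X n i x) = map_pmf (degen Y n i) (p n x)"
  shows "p \<in> sSet X (Dist Y)"
  using assms by (auto simp: sSet_def Dist_def PiE_iff extensional_def)

lemma map_pair_hom:
  assumes "h \<in> hom G H" "set_pmf a \<subseteq> carrier G" "set_pmf b \<subseteq> carrier G"
  shows "map_pmf (\<lambda>(y1, y2). y1 \<otimes>\<^bsub>H\<^esub> y2) (pair_pmf (map_pmf h a) (map_pmf h b)) =
    map_pmf h (map_pmf (\<lambda>(y1, y2). y1 \<otimes>\<^bsub>G\<^esub> y2) (pair_pmf a b))"
  using assms
  by (auto simp: map_pmf_def pair_pmf_def bind_assoc_pmf bind_return_pmf hom_mult subset_iff
      intro!: bind_pmf_cong)

lemma monoid_conv_monoid:
  assumes X: "simplicial_set X" and Y: "simplicial_group Y"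
  shows "monoid (conv_monoid X Y)"
proof -
  interpret X: simplicial_set X by fact
  interpret Y: simplicial_group Y by fact
  have car: "carrier (level Y n) = simplices Y n" for n by (simp add: level_def)
  note grp = group.is_monoid[OF Y.group_level]
  note supp = sSet_DistD(1)[unfolded fdist_def, simplified]
  show ?thesis
  proof (rule monoidI)
    fix p q assume "p \<in> carrier (conv_monoid X Y)" "q \<in> carrier (conv_monoid X Y)"
    then have p: "p \<in> sSet X (Dist Y)" and q: "q \<in> sSet X (Dist Y)"
      by (simp_all add: conv_monoid_def)
    have "p \<otimes>\<^bsub>conv_monoid X Y\<^esub> q \<in> sSet X (Dist Y)"
    proof (rule sSet_DistI)
      fix n x assume x: "x \<in> simplices X n"
      have "y1 \<otimes>\<^bsub>level Y n\<^esub> y2 \<in> simplices Y n"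
        if "y1 \<in> set_pmf (p n x)" "y2 \<in> set_pmf (q n x)" for y1 y2
        using monoid.m_closed[OF grp, of y1 n y2] that supp[OF p x] supp[OF q x]
        by (auto simp: car)
      then show "(p \<otimes>\<^bsub>conv_monoid X Y\<^esub> q) n x \<in> fdist (simplices Y n)"
        using x supp[OF p x] supp[OF q x] by (auto simp: conv_monoid_def fdist_def)
    next
      fix i n x assume i: "i \<le> Suc n" and x: "x \<in> simplices X (Suc n)"
      show "(p \<otimes>\<^bsub>conv_monoid X Y\<^esub> q) n (face X n i x) =
          map_pmf (face Y n i) ((p \<otimes>\<^bsub>conv_monoid X Y\<^esub> q) (Suc n) x)"
        using i x supp[OF p x] supp[OF q x]
        by (simp add: conv_monoid_def X.face_closed sSet_DistD(3)[OF p] sSet_DistD(3)[OF q]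
            map_pair_hom[OF Y.face_hom] car)
    next
      fix i n x assume i: "i \<le> n" and x: "x \<in> simplices X n"
      show "(p \<otimes>\<^bsub>conv_monoid X Y\<^esub> q) (Suc n) (degen X n i x) =
          map_pmf (degen Y n i) ((p \<otimes>\<^bsub>conv_monoid X Y\<^esub> q) n x)"
        using i x supp[OF p x] supp[OF q x]
        by (simp add: conv_monoid_def X.degen_closed sSet_DistD(4)[OF p] sSet_DistD(4)[OF q]
            map_pair_hom[OF Y.degen_hom] car)
    qed (simp add: conv_monoid_def)
    then show "p \<otimes>\<^bsub>conv_monoid X Y\<^esub> q \<in> carrier (conv_monoid X Y)"
      by (simp add: conv_monoid_def)
  next
    have "(\<lambda>n. \<lambda>x\<in>simplices X n. return_pmf \<one>\<^bsub>level Y n\<^esub>) \<in> sSet X (Dist Y)"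
    proof (rule sSet_DistI)
      fix n x assume x: "x \<in> simplices X n"
      show "(\<lambda>x\<in>simplices X n. return_pmf \<one>\<^bsub>level Y n\<^esub>) x \<in> fdist (simplices Y n)"
        using x monoid.one_closed[OF grp] by (simp add: fdist_def car)
    qed (auto simp: X.face_closed X.degen_closed hom_one[OF Y.face_hom] hom_one[OF Y.degen_hom]
        Y.group_level)
    then show "\<one>\<^bsub>conv_monoid X Y\<^esub> \<in> carrier (conv_monoid X Y)"
      by (simp add: conv_monoid_def)
  next
    fix p q r
    assume "p \<in> carrier (conv_monoid X Y)" "q \<in> carrier (conv_monoid X Y)"
      "r \<in> carrier (conv_monoid X Y)"
    then have p: "p \<in> sSet X (Dist Y)" and q: "q \<in> sSet X (Dist Y)" and r: "r \<in> sSet X (Dist Y)"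
      by (simp_all add: conv_monoid_def)
    show "p \<otimes>\<^bsub>conv_monoid X Y\<^esub> q \<otimes>\<^bsub>conv_monoid X Y\<^esub> r =
        p \<otimes>\<^bsub>conv_monoid X Y\<^esub> (q \<otimes>\<^bsub>conv_monoid X Y\<^esub> r)"
    proof (intro ext)
      fix n x
      show "(p \<otimes>\<^bsub>conv_monoid X Y\<^esub> q \<otimes>\<^bsub>conv_monoid X Y\<^esub> r) n x =
          (p \<otimes>\<^bsub>conv_monoid X Y\<^esub> (q \<otimes>\<^bsub>conv_monoid X Y\<^esub> r)) n x"
      proof (cases "x \<in> simplices X n")
        case True
        have "y1 \<otimes>\<^bsub>level Y n\<^esub> y2 \<otimes>\<^bsub>level Y n\<^esub> y3 = y1 \<otimes>\<^bsub>level Y n\<^esub> (y2 \<otimes>\<^bsub>level Y n\<^esub> y3)"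
          if "y1 \<in> set_pmf (p n x)" "y2 \<in> set_pmf (q n x)" "y3 \<in> set_pmf (r n x)" for y1 y2 y3
          using that supp[OF p True] supp[OF q True] supp[OF r True]
          by (intro monoid.m_assoc[OF grp]) (auto simp: car)
        then show ?thesis
          using True
          by (auto simp: conv_monoid_def map_pmf_def pair_pmf_def bind_assoc_pmf bind_return_pmf
              intro!: bind_pmf_cong)
      qed (simp add: conv_monoid_def)
    qed
  next
    fix p assume "p \<in> carrier (conv_monoid X Y)"
    then have p: "p \<in> sSet X (Dist Y)" by (simp add: conv_monoid_def)
    have unit: "bind_pmf (p n x) (\<lambda>y. return_pmf (f y)) = p n x"
      if "x \<in> simplices X n" "\<And>y. y \<in> simplices Y n \<Longrightarrow> f y = y" for n x f
      using bind_pmf_cong[OF refl, of "p n x" "\<lambda>y. return_pmf (f y)" return_pmf]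
        supp[OF p that(1)] that(2) by (auto simp: bind_return_pmf')
    have l: "y \<in> simplices Y n \<Longrightarrow> \<one>\<^bsub>level Y n\<^esub> \<otimes>\<^bsub>level Y n\<^esub> y = y"
      and r: "y \<in> simplices Y n \<Longrightarrow> y \<otimes>\<^bsub>level Y n\<^esub> \<one>\<^bsub>level Y n\<^esub> = y" for y n
      using monoid.l_one[OF grp, of y n] monoid.r_one[OF grp, of y n] by (simp_all add: car)
    show "\<one>\<^bsub>conv_monoid X Y\<^esub> \<otimes>\<^bsub>conv_monoid X Y\<^esub> p = p"
      by (intro ext) (simp add: conv_monoid_def restrict_def map_pmf_def pair_pmf_def
          bind_assoc_pmf bind_return_pmf unit l sSet_DistD(2)[OF p])
    show "p \<otimes>\<^bsub>conv_monoid X Y\<^esub> \<one>\<^bsub>conv_monoid X Y\<^esub> = p"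
      by (intro ext) (simp add: conv_monoid_def restrict_def map_pmf_def pair_pmf_def
          bind_assoc_pmf bind_return_pmf unit r sSet_DistD(2)[OF p])
  qed
qed

lemma conv_struct_closed:
  assumes X: "simplicial_set X" and Q: "Q \<in> fdist (sSet X (Dist Y))"
  shows "conv_struct X Q \<in> sSet X (Dist Y)"
proof -
  interpret X: simplicial_set X by fact
  have Q': "q \<in> sSet X (Dist Y)" if "q \<in> set_pmf Q" for q
    using Q that by (auto simp: fdist_def)
  have fin: "finite (set_pmf Q)" using Q by (simp add: fdist_def)
  show ?thesis
  proof (rule sSet_DistI)
    fix n x assume "x \<in> simplices X n"
    then show "conv_struct X Q n x \<in> fdist (simplices Y n)"
      using sSet_DistD(1)[OF Q'] fin by (fastforce simp: conv_struct_def fdist_def)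
  qed (auto simp: conv_struct_def X.face_closed X.degen_closed map_bind_pmf sSet_DistD(3,4)[OF Q']
      intro!: bind_pmf_cong)
qed

end

theory Submission imports Defs begin

text \<open>
  All three conditions on \<open>p\<close> fail exactly if some simplicial map \<open>\<phi>\<close> has its point mass occurring
  with positive weight in a convex decomposition of \<open>p\<close>. If \<open>\<phi> \<in> supp p\<close>, then finitely many
  nondegenerate simplices give a uniform positive lower bound \<open>a\<close> on the mass of \<open>\<phi>\<close>, since
  pushing forward along a degeneracy does not decrease it; hence
  \<open>p = a \<delta>\<^sup>\<phi> + (1 - a) s\<close>, where \<open>s\<close> is again simplicial because \<open>s\<close> is uniquely
  determined. Conversely, an invertible element is a point mass in every degree: if a product of
  distributions on a group is \<open>\<delta>\<^sup>e\<close>, then both factors have singleton support.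
\<close>

section \<open>Two-point convex combinations of distributions\<close>

text \<open>Encoding the mixture as a coin flip followed by a choice makes it commute with
  \<open>map_pmf\<close> and \<open>bind_pmf\<close> for every \<open>a\<close>, by associativity of
  bind. The pointwise convex formula holds for \<open>a\<close> in the unit interval.\<close>

definition mix_pmf :: "real \<Rightarrow> 'a pmf \<Rightarrow> 'a pmf \<Rightarrow> 'a pmf" where
  "mix_pmf a q s = bind_pmf (bernoulli_pmf a) (\<lambda>b. if b then q else s)"

lemma pmf_mix_pmf:
  assumes "0 \<le> a" "a \<le> 1"
  shows "pmf (mix_pmf a q s) y = a * pmf q y + (1 - a) * pmf s y"
  using assms by (simp add: mix_pmf_def pmf_bind)

lemma map_mix_pmf: "map_pmf f (mix_pmf a q s) = mix_pmf a (map_pmf f q) (map_pmf f s)"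
  unfolding mix_pmf_def map_bind_pmf by (rule bind_pmf_cong) auto

lemma bind_mix_pmf: "bind_pmf (mix_pmf a q s) f = mix_pmf a (bind_pmf q f) (bind_pmf s f)"
  unfolding mix_pmf_def bind_assoc_pmf by (rule bind_pmf_cong) auto

lemma set_mix_pmf:
  assumes "0 < a" "a < 1"
  shows "set_pmf (mix_pmf a q s) = set_pmf q \<union> set_pmf s"
  using assms by (auto simp: mix_pmf_def split: if_splits)

text \<open>Since \<open>1 - a\<close> is nonzero, the remainder can be solved for. This uniqueness
  is what later forces pointwise chosen remainders to respect faces and degeneracies.\<close>

lemma mix_pmf_cancel:
  assumes "0 < a" "a < 1" "mix_pmf a q s = mix_pmf a q s'"
  shows "s = s'"
proof (rule pmf_eqI)
  fix y
  have "pmf (mix_pmf a q s) y = pmf (mix_pmf a q s') y" by (simp add: assms(3))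
  then show "pmf s y = pmf s' y" using assms(1,2) by (simp add: pmf_mix_pmf)
qed

text \<open>Solving for \<open>s\<close> leaves only the density \<open>f\<close> below. The bound
  \<open>a \<le> pmf r y\<close> keeps it nonnegative at \<open>y\<close>, and its total mass is
  \<open>(1 - a) / (1 - a)\<close>.\<close>

lemma mix_pmf_return_exists:
  assumes r: "finite (set_pmf r)" and a: "0 < a" "a < 1" "a \<le> pmf r y"
  shows "\<exists>s. r = mix_pmf a (return_pmf y) s"
proof -
  define f where "f z = (pmf r z - a * pmf (return_pmf y) z) / (1 - a)" for z
  have nonneg: "f z \<ge> 0" for z
    using a by (auto simp: f_def indicator_def)
  \<comment> \<open>As \<open>y\<close> already carries mass in \<open>r\<close>, subtracting mass
    there creates no new support point, so \<open>f\<close> has finite support.\<close>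
  have y: "y \<in> set_pmf r" using a by (auto simp: set_pmf_iff)
  have sub: "{z \<in> UNIV. f z \<noteq> 0} \<subseteq> set_pmf r"
    using y by (auto simp: f_def set_pmf_iff indicator_def)
  have "(\<Sum>z\<in>{z \<in> UNIV. f z \<noteq> 0}. f z) = (\<Sum>z\<in>set_pmf r. f z)"
    by (rule sum.mono_neutral_left[OF r sub]) auto
  also have "\<dots> = ((\<Sum>z\<in>set_pmf r. pmf r z) - a * (\<Sum>z\<in>set_pmf r. pmf (return_pmf y) z)) / (1 - a)"
    by (simp add: f_def sum_divide_distrib[symmetric] sum_subtractf sum_distrib_left)
  also have "(\<Sum>z\<in>set_pmf r. pmf (return_pmf y) z) = 1"
    using y r by (intro sum_pmf_eq_1) auto
  also have "(\<Sum>z\<in>set_pmf r. pmf r z) = 1"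
    using r by (simp add: sum_pmf_eq_1)
  finally have sum: "(\<Sum>z\<in>{z \<in> UNIV. f z \<noteq> 0}. f z) = 1" using a by simp
  obtain s where s: "\<And>z. pmf s z = f z"
    using fdist_of_function[of UNIV f, OF nonneg finite_subset[OF sub r] sum] by auto
  have "r = mix_pmf a (return_pmf y) s"
    using a by (intro pmf_eqI) (simp add: pmf_mix_pmf s f_def)
  then show ?thesis ..
qed

section \<open>Simplicial maps and their point masses\<close>

lemma sSetD:
  assumes "\<phi> \<in> sSet X Y"
  shows "x \<in> simplices X n \<Longrightarrow> \<phi> n x \<in> simplices Y n"
    and "x \<notin> simplices X n \<Longrightarrow> \<phi> n x = undefined"
    and "\<lbrakk>i \<le> Suc n; x \<in> simplices X (Suc n)\<rbrakk> \<Longrightarrow> \<phi> n (face X n i x) = face Y n i (\<phi> (Suc n) x)"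
    and "\<lbrakk>i \<le> n; x \<in> simplices X n\<rbrakk> \<Longrightarrow> \<phi> (Suc n) (degen X n i x) = degen Y n i (\<phi> n x)"
  using assms by (auto simp: sSet_def PiE_iff extensional_def)

lemma sSetI:
  assumes "\<And>n x. x \<in> simplices X n \<Longrightarrow> \<phi> n x \<in> simplices Y n"
    and "\<And>n x. x \<notin> simplices X n \<Longrightarrow> \<phi> n x = undefined"
    and "\<And>i n x. \<lbrakk>i \<le> Suc n; x \<in> simplices X (Suc n)\<rbrakk> \<Longrightarrow>
      \<phi> n (face X n i x) = face Y n i (\<phi> (Suc n) x)"
    and "\<And>i n x. \<lbrakk>i \<le> n; x \<in> simplices X n\<rbrakk> \<Longrightarrow>
      \<phi> (Suc n) (degen X n i x) = degen Y n i (\<phi> n x)"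
  shows "\<phi> \<in> sSet X Y"
  using assms by (auto simp: sSet_def PiE_iff extensional_def)

lemma Theta_return_pmf:
  "Theta X (return_pmf \<phi>) = (\<lambda>n. \<lambda>x\<in>simplices X n. return_pmf (\<phi> n x))"
  by (simp add: Theta_def bind_return_pmf)

lemma Theta_return_closed:
  assumes "simplicial_set X" "\<phi> \<in> sSet X Y"
  shows "Theta X (return_pmf \<phi>) \<in> sSet X (Dist Y)"
proof -
  interpret X: simplicial_set X by fact
  show ?thesis
    by (rule sSet_DistI)
      (auto simp: Theta_return_pmf fdist_def sSetD[OF assms(2)] X.face_closed X.degen_closed)
qed

text \<open>The fibre of \<open>f\<close> over \<open>f y\<close> contains \<open>y\<close>. This
  carries lower bounds from a simplex to its degeneracies.\<close>

lemma pmf_le_pmf_map: "pmf r y \<le> pmf (map_pmf f r) (f y)"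
  unfolding pmf_map by (subst measure_pmf_single[symmetric])
    (rule measure_pmf.finite_measure_mono, auto)

section \<open>Splitting off a point mass from the support\<close>

lemma supp_lower_bound:
  assumes fin: "finite (nondegenerate_simplices X)" and p: "p \<in> sSet X (Dist Y)"
    and \<phi>: "\<phi> \<in> supp X Y p"
  obtains a where "0 < a" "a < 1" "\<And>n x. x \<in> simplices X n \<Longrightarrow> a \<le> pmf (p n x) (\<phi> n x)"
proof -
  \<comment> \<open>The extra element \<open>1/2\<close> keeps \<open>B\<close> nonempty even if
    \<open>X\<close> is empty, and forces \<open>Min B < 1\<close>, so that the remainder has
    positive weight.\<close>
  define B where "B = insert (1/2) ((\<lambda>(n, x). pmf (p n x) (\<phi> n x)) ` nondegenerate_simplices X)"
  have B: "finite B" "B \<noteq> {}" using fin by (auto simp: B_def)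
  have \<phi>': "\<phi> \<in> sSet X Y" using \<phi> by (simp add: supp_def)
  have "Min B > 0"
    using \<phi> by (subst Min_gr_iff[OF B])
      (auto simp: B_def nondegenerate_simplices_def supp_def pmf_nonneg less_le)
  moreover have "Min B \<le> 1/2" by (rule Min_le[OF B(1)]) (simp add: B_def)
  then have "Min B < 1" by simp
  \<comment> \<open>Induction on the degree strips one degeneracy at a time until a nondegenerate
    simplex is reached, whose mass is a member of \<open>B\<close>. In degree 0 no simplex is
    degenerate.\<close>
  moreover have "Min B \<le> pmf (p n x) (\<phi> n x)" if "x \<in> simplices X n" for n x
    using that
  proof (induction n arbitrary: x)
    case 0
    then show ?case
      by (intro Min_le B) (force simp: B_def nondegenerate_simplices_def degenerate_def)
  next
    case (Suc n)
    show ?case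
    proof (cases "degenerate X (Suc n) x")
      case True
      then obtain i y where y: "i \<le> n" "y \<in> simplices X n" "x = degen X n i y"
        by (auto simp: degenerate_def)
      have "Min B \<le> pmf (p n y) (\<phi> n y)" by (rule Suc.IH) fact
      also have "\<dots> \<le> pmf (p (Suc n) x) (\<phi> (Suc n) x)"
        using y by (simp add: sSet_DistD(4)[OF p] sSetD(4)[OF \<phi>'] pmf_le_pmf_map)
      finally show ?thesis .
    next
      case False
      then show ?thesis using Suc.prems
        by (intro Min_le B) (force simp: B_def nondegenerate_simplices_def)
    qed
  qed
  ultimately show thesis by (rule that)
qed

lemma supp_decomposition:
  assumes X: "simplicial_set X" and fin: "finite (nondegenerate_simplices X)"
    and p: "p \<in> sSet X (Dist Y)" and \<phi>: "\<phi> \<in> supp X Y p"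
  obtains a s where "0 < a" "a < 1" "s \<in> sSet X (Dist Y)"
    "\<And>n x. x \<in> simplices X n \<Longrightarrow> p n x = mix_pmf a (return_pmf (\<phi> n x)) (s n x)"
proof -
  interpret X: simplicial_set X by fact
  obtain a where a: "0 < a" "a < 1"
    and le: "\<And>n x. x \<in> simplices X n \<Longrightarrow> a \<le> pmf (p n x) (\<phi> n x)"
    using supp_lower_bound[OF fin p \<phi>] by blast
  have \<phi>': "\<phi> \<in> sSet X Y" using \<phi> by (simp add: supp_def)
  \<comment> \<open>The remainders are chosen independently on each simplex; compatibility is
    recovered afterwards from \<open>mix_pmf_cancel\<close>.\<close>
  define s where "s n = (\<lambda>x\<in>simplices X n. SOME s. p n x = mix_pmf a (return_pmf (\<phi> n x)) s)" for n
  have s: "p n x = mix_pmf a (return_pmf (\<phi> n x)) (s n x)" if x: "x \<in> simplices X n" for n x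
    using someI_ex[OF mix_pmf_return_exists[OF set_pmf_sSet_Dist(2)[OF p x] a le[OF x]]] x
    by (simp add: s_def)
  have "s \<in> sSet X (Dist Y)"
  proof (rule sSet_DistI)
    fix n x assume x: "x \<in> simplices X n"
    have "set_pmf (s n x) \<subseteq> set_pmf (p n x)"
      unfolding s[OF x] by (auto simp: set_mix_pmf[OF a])
    then show "s n x \<in> fdist (simplices Y n)"
      using set_pmf_sSet_Dist[OF p x] by (auto simp: fdist_def intro: finite_subset)
  next
    fix i n x assume x: "i \<le> Suc n" "x \<in> simplices X (Suc n)"
    \<comment> \<open>The remainder at the face and the pushed-forward remainder both complete the
      same point mass to the value of \<open>p\<close> at the face, so they coincide. Degeneracies
      are treated alike.\<close>
    have "mix_pmf a (return_pmf (\<phi> n (face X n i x))) (s n (face X n i x)) =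
        map_pmf (face Y n i) (p (Suc n) x)"
      using x by (simp add: s[symmetric] X.face_closed sSet_DistD(3)[OF p])
    also have "\<dots> = mix_pmf a (return_pmf (\<phi> n (face X n i x))) (map_pmf (face Y n i) (s (Suc n) x))"
      using x by (simp add: s map_mix_pmf sSetD(3)[OF \<phi>'])
    finally show "s n (face X n i x) = map_pmf (face Y n i) (s (Suc n) x)"
      by (rule mix_pmf_cancel[OF a])
  next
    fix i n x assume x: "i \<le> n" "x \<in> simplices X n"
    have "mix_pmf a (return_pmf (\<phi> (Suc n) (degen X n i x))) (s (Suc n) (degen X n i x)) =
        map_pmf (degen Y n i) (p n x)"
      using x by (simp add: s[symmetric] X.degen_closed sSet_DistD(4)[OF p])
    also have "\<dots> = mix_pmf a (return_pmf (\<phi> (Suc n) (degen X n i x))) (map_pmf (degen Y n i) (s n x))"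
      using x by (simp add: s map_mix_pmf sSetD(4)[OF \<phi>'])
    finally show "s (Suc n) (degen X n i x) = map_pmf (degen Y n i) (s n x)"
      by (rule mix_pmf_cancel[OF a])
  qed (simp add: s_def)
  then show thesis using a s by (intro that)
qed

section \<open>Units of the convex monoid\<close>

text \<open>Faces and degeneracies are group homomorphisms, hence commute with inversion. This
  supplies the inverse of a point mass.\<close>

lemma sSet_inverse_closed:
  assumes "simplicial_set X" "simplicial_group Y" and \<phi>: "\<phi> \<in> sSet X Y"
  shows "(\<lambda>n. \<lambda>x\<in>simplices X n. inv\<^bsub>level Y n\<^esub> \<phi> n x) \<in> sSet X Y"
proof -
  interpret X: simplicial_set X by fact
  interpret Y: simplicial_group Y by fact
  have car: "carrier (level Y n) = simplices Y n" for n by (simp add: level_def)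
  have hom: "inv\<^bsub>level Y m\<^esub> h y = h (inv\<^bsub>level Y n\<^esub> y)"
    if "h \<in> hom (level Y n) (level Y m)" "y \<in> simplices Y n" for h n m y
    using group_hom.hom_inv[of "level Y n" "level Y m" h y] that Y.group_level
    by (simp add: group_hom_def group_hom_axioms_def car)
  show ?thesis
  proof (rule sSetI)
    fix n x assume "x \<in> simplices X n"
    then show "(\<lambda>x\<in>simplices X n. inv\<^bsub>level Y n\<^esub> \<phi> n x) x \<in> simplices Y n"
      using group.inv_closed[OF Y.group_level, of "\<phi> n x" n] by (simp add: car sSetD(1)[OF \<phi>])
  qed (simp_all add: X.face_closed X.degen_closed sSetD[OF \<phi>] hom Y.face_hom Y.degen_hom)
qed

text \<open>Point masses multiply like the underlying group elements, so the pointwise inverse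
  \<open>\<psi>\<close> of \<open>\<phi>\<close> gives a two-sided inverse.\<close>

lemma Theta_return_Units:
  assumes X: "simplicial_set X" and Y: "simplicial_group Y" and \<phi>: "\<phi> \<in> sSet X Y"
  shows "Theta X (return_pmf \<phi>) \<in> Units (conv_monoid X Y)"
proof -
  interpret Y: simplicial_group Y by fact
  define \<psi> where "\<psi> = (\<lambda>n. \<lambda>x\<in>simplices X n. inv\<^bsub>level Y n\<^esub> \<phi> n x)"
  have \<psi>: "\<psi> \<in> sSet X Y" unfolding \<psi>_def by (rule sSet_inverse_closed[OF X Y \<phi>])
  have inv: "\<phi> n x \<otimes>\<^bsub>level Y n\<^esub> \<psi> n x = \<one>\<^bsub>level Y n\<^esub>"
    "\<psi> n x \<otimes>\<^bsub>level Y n\<^esub> \<phi> n x = \<one>\<^bsub>level Y n\<^esub>" if "x \<in> simplices X n" for n x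
    using sSetD(1)[OF \<phi> that] that group.r_inv[OF Y.group_level, of "\<phi> n x" n]
      group.l_inv[OF Y.group_level, of "\<phi> n x" n]
    by (simp_all add: \<psi>_def level_def)
  have "Theta X (return_pmf \<psi>) \<otimes>\<^bsub>conv_monoid X Y\<^esub> Theta X (return_pmf \<phi>) = \<one>\<^bsub>conv_monoid X Y\<^esub>"
    "Theta X (return_pmf \<phi>) \<otimes>\<^bsub>conv_monoid X Y\<^esub> Theta X (return_pmf \<psi>) = \<one>\<^bsub>conv_monoid X Y\<^esub>"
    by (auto simp: conv_monoid_def Theta_return_pmf pair_return_pmf1 inv
        intro!: ext restrict_ext)
  moreover have "Theta X (return_pmf \<phi>) \<in> carrier (conv_monoid X Y)"
    "Theta X (return_pmf \<psi>) \<in> carrier (conv_monoid X Y)"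
    by (simp_all add: conv_monoid_def Theta_return_closed X \<phi> \<psi>)
  ultimately show ?thesis unfolding Units_def by blast
qed

text \<open>Every pair of outcomes multiplies to the identity, so one fixed outcome
  \<open>y2\<close> of \<open>b\<close> pins all outcomes of \<open>a\<close> to
  \<open>inv y2\<close>.\<close>

lemma (in group) set_pmf_singleton_if_mult_eq_return:
  assumes a: "set_pmf a \<subseteq> carrier G" and b: "set_pmf b \<subseteq> carrier G"
    and ab: "map_pmf (\<lambda>(y1, y2). y1 \<otimes> y2) (pair_pmf a b) = return_pmf \<one>"
  shows "\<exists>y. a = return_pmf y"
proof -
  have mult: "y1 \<otimes> y2 = \<one>" if "y1 \<in> set_pmf a" "y2 \<in> set_pmf b" for y1 y2
  proof -
    have "y1 \<otimes> y2 \<in> set_pmf (map_pmf (\<lambda>(y1, y2). y1 \<otimes> y2) (pair_pmf a b))"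
      using that by force
    then show ?thesis by (simp add: ab)
  qed
  obtain y2 where "y2 \<in> set_pmf b" using set_pmf_not_empty[of b] by blast
  then have "set_pmf a \<subseteq> {inv y2}"
    using mult a b by (auto intro: inv_equality[symmetric])
  then show ?thesis by (auto simp: set_pmf_subset_singleton)
qed

text \<open>Together with \<open>Theta_return_Units\<close>, this identifies the units with the
  point masses of simplicial maps.\<close>

lemma Units_conv_monoid_Theta:
  assumes X: "simplicial_set X" and Y: "simplicial_group Y"
    and m: "m \<in> Units (conv_monoid X Y)"
  obtains \<phi> where "\<phi> \<in> sSet X Y" "m = Theta X (return_pmf \<phi>)"
proof -
  interpret X: simplicial_set X by fact
  interpret Y: simplicial_group Y by fact
  have car: "carrier (level Y n) = simplices Y n" for n by (simp add: level_def)
  obtain q where q: "q \<in> sSet X (Dist Y)" and mq: "m \<otimes>\<^bsub>conv_monoid X Y\<^esub> q = \<one>\<^bsub>conv_monoid X Y\<^esub>"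
    and mS: "m \<in> sSet X (Dist Y)"
    using m by (auto simp: Units_def conv_monoid_def)
  have point: "\<exists>y. m n x = return_pmf y" if x: "x \<in> simplices X n" for n x
  proof (rule group.set_pmf_singleton_if_mult_eq_return[OF Y.group_level])
    show "set_pmf (m n x) \<subseteq> carrier (level Y n)" "set_pmf (q n x) \<subseteq> carrier (level Y n)"
      using set_pmf_sSet_Dist(1)[OF mS x] set_pmf_sSet_Dist(1)[OF q x] by (simp_all add: car)
    show "map_pmf (\<lambda>(y1, y2). y1 \<otimes>\<^bsub>level Y n\<^esub> y2) (pair_pmf (m n x) (q n x)) = return_pmf \<one>\<^bsub>level Y n\<^esub>"
      using fun_cong[OF fun_cong[OF mq, of n], of x] x by (simp add: conv_monoid_def)
  qed
  define \<phi> where "\<phi> n = (\<lambda>x\<in>simplices X n. SOME y. m n x = return_pmf y)" for n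
  have \<phi>: "m n x = return_pmf (\<phi> n x)" if x: "x \<in> simplices X n" for n x
    using someI_ex[OF point[OF x]] x by (simp add: \<phi>_def)
  \<comment> \<open>Since \<open>return_pmf\<close> is injective, the simplicial identities of
    \<open>m\<close> descend to \<open>\<phi>\<close>.\<close>
  have "\<phi> \<in> sSet X Y"
  proof (rule sSetI)
    fix n x assume x: "x \<in> simplices X n"
    show "\<phi> n x \<in> simplices Y n"
      using set_pmf_sSet_Dist(1)[OF mS x] by (simp add: \<phi>[OF x])
  next
    fix i n x assume "i \<le> Suc n" "x \<in> simplices X (Suc n)"
    then show "\<phi> n (face X n i x) = face Y n i (\<phi> (Suc n) x)"
      using sSet_DistD(3)[OF mS, of i n x] by (simp add: \<phi> X.face_closed)
  next
    fix i n x assume "i \<le> n" "x \<in> simplices X n"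
    then show "\<phi> (Suc n) (degen X n i x) = degen Y n i (\<phi> n x)"
      using sSet_DistD(4)[OF mS, of i n x] by (simp add: \<phi> X.degen_closed)
  qed (simp add: \<phi>_def)
  moreover have "m = Theta X (return_pmf \<phi>)"
    by (intro ext) (simp add: Theta_return_pmf \<phi> restrict_def sSet_DistD(2)[OF mS])
  ultimately show thesis by (rule that)
qed

section \<open>Comparing the support with invertible support and noncontextual fraction\<close>

lemma Isupp_nonempty_iff_supp:
  assumes X: "simplicial_set X" and fin: "finite (nondegenerate_simplices X)"
    and Y: "simplicial_group Y" and p: "p \<in> sSet X (Dist Y)"
  shows "Isupp (conv_monoid X Y) (conv_struct X) p \<noteq> {} \<longleftrightarrow> supp X Y p \<noteq> {}"
proof
  assume "supp X Y p \<noteq> {}"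
  then obtain \<phi> where \<phi>: "\<phi> \<in> supp X Y p" by blast
  then have \<phi>': "\<phi> \<in> sSet X Y" by (simp add: supp_def)
  obtain a s where a: "0 < a" "a < 1" and s: "s \<in> sSet X (Dist Y)"
    and dec: "\<And>n x. x \<in> simplices X n \<Longrightarrow> p n x = mix_pmf a (return_pmf (\<phi> n x)) (s n x)"
    using supp_decomposition[OF X fin p \<phi>] by metis
  \<comment> \<open>The decomposition of \<open>p\<close> is lifted to a distribution on the monoid
    itself, charging the unit given by \<open>\<phi>\<close> and the remainder
    \<open>s\<close>.\<close>
  define P where "P = mix_pmf a (return_pmf (Theta X (return_pmf \<phi>))) (return_pmf s)"
  have set: "set_pmf P = {Theta X (return_pmf \<phi>), s}"
    by (auto simp: P_def set_mix_pmf[OF a])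
  have "conv_struct X P = p"
    by (intro ext)
      (simp add: conv_struct_def P_def bind_mix_pmf bind_return_pmf Theta_return_pmf dec
        restrict_def sSet_DistD(2)[OF p])
  moreover have "P \<in> fdist (carrier (conv_monoid X Y))"
    by (simp add: fdist_def set s conv_monoid_def Theta_return_closed[OF X \<phi>'])
  \<comment> \<open>The remainder may equal the unit, so positivity is read off the support instead
    of computing the weight as \<open>a\<close>.\<close>
  moreover have "pmf P (Theta X (return_pmf \<phi>)) \<noteq> 0"
    using set by (simp flip: set_pmf_iff)
  ultimately show "Isupp (conv_monoid X Y) (conv_struct X) p \<noteq> {}"
    using Theta_return_Units[OF X Y \<phi>'] by (auto simp: Isupp_def)
next
  assume "Isupp (conv_monoid X Y) (conv_struct X) p \<noteq> {}"
  then obtain m P where m: "m \<in> Units (conv_monoid X Y)" and mP: "m \<in> set_pmf P"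
    and P: "conv_struct X P = p"
    by (auto simp: Isupp_def set_pmf_iff)
  obtain \<phi> where \<phi>: "\<phi> \<in> sSet X Y" and m_eq: "m = Theta X (return_pmf \<phi>)"
    using Units_conv_monoid_Theta[OF X Y m] by blast
  \<comment> \<open>A unit charged by \<open>P\<close> contributes its single outcome to the mixture
    \<open>p\<close> at every simplex.\<close>
  have "\<phi> n x \<in> set_pmf (p n x)" if "x \<in> simplices X n" for n x
    using mP that by (force simp: P[symmetric] conv_struct_def m_eq Theta_return_pmf)
  then have "\<phi> \<in> supp X Y p" using \<phi> by (simp add: supp_def set_pmf_iff)
  then show "supp X Y p \<noteq> {}" by blast
qed

text \<open>A nonzero supremum of weights yields one decomposition of positive weight, and any map
  occurring in its noncontextual part lies in the support.\<close>

lemma NCF_nonzero_iff_supp: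
  assumes X: "simplicial_set X" and fin: "finite (nondegenerate_simplices X)"
    and Y: "simplicial_group Y" and p: "p \<in> sSet X (Dist Y)"
  shows "NCF X Y p \<noteq> 0 \<longleftrightarrow> supp X Y p \<noteq> {}"
proof -
  interpret X: simplicial_set X by fact
  interpret Y: simplicial_group Y by fact
  define A where "A = {\<alpha> \<in> {0..1}.
    \<exists>q \<in> sSet X (Dist Y). \<exists>s \<in> sSet X (Dist Y). noncontextual X Y q \<and>
      (\<forall>n. \<forall>x \<in> simplices X n. \<forall>y.
        pmf (p n x) y = \<alpha> * pmf (q n x) y + (1 - \<alpha>) * pmf (s n x) y)}"
  have NCF: "NCF X Y p = Sup A" by (simp add: NCF_def A_def)
  have nc: "noncontextual X Y (Theta X (return_pmf \<phi>))" if "\<phi> \<in> sSet X Y" for \<phi>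
    using that by (simp add: noncontextual_def fdist_def)
  have bdd: "bdd_above A" by (rule bdd_aboveI[of _ 1]) (simp add: A_def)
  show ?thesis
  proof
    assume "supp X Y p \<noteq> {}"
    then obtain \<phi> where \<phi>: "\<phi> \<in> supp X Y p" by blast
    then have \<phi>': "\<phi> \<in> sSet X Y" by (simp add: supp_def)
    obtain a s where a: "0 < a" "a < 1" and s: "s \<in> sSet X (Dist Y)"
      and dec: "\<And>n x. x \<in> simplices X n \<Longrightarrow> p n x = mix_pmf a (return_pmf (\<phi> n x)) (s n x)"
      using supp_decomposition[OF X fin p \<phi>] by metis
    have "\<forall>n. \<forall>x \<in> simplices X n. \<forall>y. pmf (p n x) y =
        a * pmf (Theta X (return_pmf \<phi>) n x) y + (1 - a) * pmf (s n x) y"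
      using a by (simp add: dec pmf_mix_pmf Theta_return_pmf)
    then have "a \<in> A"
      unfolding A_def using a s nc[OF \<phi>'] Theta_return_closed[OF X \<phi>'] by auto
    then have "a \<le> Sup A" using bdd by (rule cSup_upper)
    then show "NCF X Y p \<noteq> 0" using a NCF by simp
  next
    assume ne: "NCF X Y p \<noteq> 0"
    \<comment> \<open>The constant identity map is simplicial because faces and degeneracies
      preserve identities. With \<open>s = p\<close> it witnesses the weight 0, so the supremum is
      over a nonempty set.\<close>
    define e where "e n = (\<lambda>x\<in>simplices X n. \<one>\<^bsub>level Y n\<^esub>)" for n
    have "\<one>\<^bsub>level Y n\<^esub> \<in> simplices Y n" for n
      using monoid.one_closed[OF group.is_monoid[OF Y.group_level], of n] by (simp add: level_def)
    then have e: "e \<in> sSet X Y"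
      by (intro sSetI) (simp_all add: e_def X.face_closed X.degen_closed Y.group_level
          hom_one[OF Y.face_hom] hom_one[OF Y.degen_hom])
    have "0 \<in> A"
      unfolding A_def
      by (rule CollectI, intro conjI bexI[OF _ Theta_return_closed[OF X e]] bexI[OF _ p] nc[OF e])
        simp_all
    \<comment> \<open>Otherwise \<open>A = {0}\<close>, whose supremum is 0.\<close>
    have "\<exists>\<alpha>\<in>A. \<alpha> > 0"
    proof (rule ccontr)
      assume "\<not> ?thesis"
      moreover have "\<alpha> \<ge> 0" if "\<alpha> \<in> A" for \<alpha> using that by (simp add: A_def)
      ultimately have "A = {0}" using \<open>0 \<in> A\<close> by (auto intro: antisym simp: not_less)
      then show False using ne NCF by simp
    qed
    then obtain \<alpha> where "\<alpha> \<in> A" and pos: "0 < \<alpha>" by blast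
    then obtain q s where \<alpha>: "\<alpha> \<le> 1" and q: "noncontextual X Y q"
      and dec: "\<And>n x y. x \<in> simplices X n \<Longrightarrow>
        pmf (p n x) y = \<alpha> * pmf (q n x) y + (1 - \<alpha>) * pmf (s n x) y"
      unfolding A_def mem_Collect_eq atLeastAtMost_iff by blast
    obtain d where d: "d \<in> fdist (sSet X Y)" and q_eq: "q = Theta X d"
      using q by (auto simp: noncontextual_def)
    \<comment> \<open>Any map charged by \<open>d\<close> has positive mass in \<open>q\<close> at
      all simplices at once; the factor \<open>\<alpha> > 0\<close> passes this on to
      \<open>p\<close>.\<close>
    obtain \<phi> where \<phi>: "\<phi> \<in> set_pmf d" using set_pmf_not_empty[of d] by blast
    have "pmf (p n x) (\<phi> n x) \<noteq> 0" if x: "x \<in> simplices X n" for n x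
    proof -
      have "\<phi> n x \<in> set_pmf (q n x)"
        using \<phi> x by (force simp: q_eq Theta_def)
      then have "\<alpha> * pmf (q n x) (\<phi> n x) > 0"
        using pos by (simp add: pmf_positive)
      moreover have "(1 - \<alpha>) * pmf (s n x) (\<phi> n x) \<ge> 0" using \<alpha> by simp
      ultimately show ?thesis using dec[OF x, of "\<phi> n x"] by linarith
    qed
    then have "\<phi> \<in> supp X Y p" using \<phi> d by (auto simp: supp_def fdist_def)
    then show "supp X Y p \<noteq> {}" by blast
  qed
qed

theorem corollary5p11:
  fixes X :: "'a sset" and Y :: "'b sgroup" and p :: "nat \<Rightarrow> 'a \<Rightarrow> 'b pmf"
  assumes "simplicial_set X"
    and "finite (nondegenerate_simplices X)"
    and "simplicial_group Y"
    and "p \<in> sSet X (Dist Y)"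
  shows "(strongly_contextual X Y p \<longleftrightarrow>
            strongly_non_invertible (conv_monoid X Y) (conv_struct X) p) \<and>
         (strongly_contextual X Y p \<longleftrightarrow> CF X Y p = 1)"
  using Isupp_nonempty_iff_supp[OF assms] NCF_nonzero_iff_supp[OF assms]
  by (auto simp: strongly_contextual_def strongly_non_invertible_def CF_def)

end
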